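(* There exists a partially hyperbolic surface endomorphism $f:\mathbb{T}^2\to\mathbb{T}^2$ which is homotopic to the linear map of $\mathbb{T}^2$ induced by the matrix $\begin{pmatrix} 2 & 0\\ 0 & 2\end{pmatrix}$.
   Context: $\mathbb{T}^2=\mathbb{R}^2/\mathbb{Z}^2$. Cone families: on a surface $M$, a cone family $\mathcal{C}$ is a choice at each $p\in M$ of a closed cone $\mathcal{C}(p)=\{v\in T_pM: Q_p(v)\ge 0\}$, where $Q_p$ is a nondegenerate indefinite quadratic form on $T_pM$ depending continuously on $p$. It is $Df$-invariant if $D_pf(\mathcal{C}(p))$ is contained in the interior of $\mathcal{C}(f(p))$ (apart from the zero vector) for all $p\in M$. A map $f:M\to M$ is a (weakly) partially hyperbolic endomorphism if it is a ($C^1$) local diffeomorphism and there is a $Df$-invariant cone family $\mathcal{C}^u$ and $k>0$ such that $\|Df^k v^u\|>1$ for all unit vectors $v^u\in\mathcal{C}^u$. *)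

theory Defs
  imports "HOL-Analysis.Analysis"
begin

section \<open>The torus as a quotient space\<close>

definition torus_rel :: "real^2 \<Rightarrow> real^2 \<Rightarrow> bool"
  where "torus_rel x y \<longleftrightarrow> (\<forall>i. x $ i - y $ i \<in> \<int>)"

lemma torus_rel_equivp: "equivp torus_rel"
proof (rule equivpI)
  show "reflp torus_rel"
    by (auto intro!: reflpI simp: torus_rel_def)
  show "symp torus_rel"
    by (auto intro!: sympI simp: torus_rel_def) (metis Ints_minus minus_diff_eq)
  show "transp torus_rel"
  proof (rule transpI)
    fix x y z assume "torus_rel x y" "torus_rel y z"
    then have "(x $ i - y $ i) + (y $ i - z $ i) \<in> \<int>" for i
      unfolding torus_rel_def by (intro Ints_add) auto
    then show "torus_rel x z"
      by (simp add: torus_rel_def)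
  qed
qed

quotient_type torus = "real^2" / torus_rel
  morphisms torus_rep torus_proj
  by (rule torus_rel_equivp)

lemma torus_proj_eq_iff: "torus_proj x = torus_proj y \<longleftrightarrow> (\<forall>i. x $ i - y $ i \<in> \<int>)"
  using torus.abs_eq_iff by (simp add: torus_rel_def)

instantiation torus :: topological_space
begin

definition open_torus :: "torus set \<Rightarrow> bool"
  where "open_torus U \<longleftrightarrow> open (torus_proj -` U)"

instance
proof
  show "open (UNIV :: torus set)"
    by (simp add: open_torus_def)
  show "open (S \<inter> T)" if "open S" "open T" for S T :: "torus set"
    using that by (auto simp: open_torus_def vimage_Int)
  show "open (\<Union>K)" if "\<forall>S\<in>K. open S" for K :: "torus set set"
    using that by (auto simp: open_torus_def vimage_Union)
qed

end

text \<open>Integer matrices are exactly the ones whose linear action descends to the torus.\<close>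

lift_definition torus_linear :: "int^2^2 \<Rightarrow> torus \<Rightarrow> torus"
  is "\<lambda>A x. (\<chi> i j. real_of_int (A $ i $ j)) *v x"
proof -
  fix A :: "int^2^2" and x y :: "real^2"
  assume xy: "torus_rel x y"
  have "(\<Sum>j\<in>UNIV. real_of_int (A $ i $ j) * (x $ j - y $ j)) \<in> \<int>" for i
    using xy by (intro Ints_sum Ints_mult) (auto simp: torus_rel_def)
  then show "torus_rel ((\<chi> i j. real_of_int (A $ i $ j)) *v x) ((\<chi> i j. real_of_int (A $ i $ j)) *v y)"
    by (simp add: torus_rel_def matrix_vector_mult_def sum_subtractf right_diff_distrib)
qed


section \<open>Differentiable maps of the torus\<close>

text \<open>
  Every tangent space of the torus is identified with \<^typ>\<open>real^2\<close> by the derivative of the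
  projection; the flat metric of the torus is then the Euclidean norm. Under this identification
  the derivative of \<open>f\<close> at \<open>p\<close> is the ordinary derivative of any local lift \<open>F\<close> of \<open>f\<close>
  at a point over \<open>p\<close>; it does not depend on the lift (see below).
\<close>

definition torus_has_derivative ::
    "(torus \<Rightarrow> torus) \<Rightarrow> (real^2 \<Rightarrow> real^2) \<Rightarrow> torus \<Rightarrow> bool"
  where "torus_has_derivative f L p \<longleftrightarrow>
    (\<exists>x F. torus_proj x = p \<and>
           (\<forall>\<^sub>F z in nhds x. torus_proj (F z) = f (torus_proj z)) \<and>
           (F has_derivative L) (at x))"

definition torus_deriv :: "(torus \<Rightarrow> torus) \<Rightarrow> torus \<Rightarrow> real^2 \<Rightarrow> real^2"
  where "torus_deriv f p = (THE L. torus_has_derivative f L p)"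

lemma torus_has_derivative_unique:
  assumes "torus_has_derivative f L p" and "torus_has_derivative f M p"
  shows "L = M"
proof -
  obtain x F where x: "torus_proj x = p" and F: "\<forall>\<^sub>F z in nhds x. torus_proj (F z) = f (torus_proj z)"
    and dF: "(F has_derivative L) (at x)"
    using assms(1) unfolding torus_has_derivative_def by auto
  obtain y G where y: "torus_proj y = p" and G: "\<forall>\<^sub>F z in nhds y. torus_proj (G z) = f (torus_proj z)"
    and dG: "(G has_derivative M) (at y)"
    using assms(2) unfolding torus_has_derivative_def by auto
  define n where "n = y - x"
  have n: "n $ i \<in> \<int>" for i
    using x y torus_proj_eq_iff[of y x] by (simp add: n_def)
  have proj_n: "torus_proj (z + n) = torus_proj z" for z
    using n by (simp add: torus_proj_eq_iff)
  define H where "H z = G (z + n) - F z" for z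
  have dGn: "((\<lambda>z. G (z + n)) has_derivative M) (at x)"
    using has_derivative_compose[of "\<lambda>z. z + n" "\<lambda>z. z" x UNIV G M] dG
    by (simp add: n_def has_derivative_add_const)
  have dH: "(H has_derivative (\<lambda>v. M v - L v)) (at x)"
    unfolding H_def by (intro has_derivative_diff dGn dF)
  have "((\<lambda>z. z + n) \<longlongrightarrow> x + n) (at x)"
    by (intro tendsto_intros)
  then have "((\<lambda>z. z + n) \<longlongrightarrow> x + n) (nhds x)"
    using tendsto_at_iff_tendsto_nhds[of "\<lambda>z. z + n" x] by simp
  then have "filterlim (\<lambda>z. z + n) (nhds y) (nhds x)"
    by (simp add: n_def)
  then have "\<forall>\<^sub>F z in nhds x. torus_proj (G (z + n)) = f (torus_proj (z + n))"
    using G by (rule eventually_compose_filterlim[rotated])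
  with F have int: "\<forall>\<^sub>F z in nhds x. \<forall>i. H z $ i \<in> \<int>"
    by eventually_elim (auto simp: proj_n H_def torus_proj_eq_iff[symmetric])
  have "isCont H x"
    using dH by (rule has_derivative_continuous)
  then have "\<forall>\<^sub>F z in nhds x. dist (H z) (H x) < 1"
    by (metis tendsto_at_iff_tendsto_nhds isCont_def tendstoD zero_less_one)
  then have const: "\<forall>\<^sub>F z in nhds x. H z = H x"
    using int
  proof eventually_elim
    case (elim z)
    have "H z $ i = H x $ i" for i
    proof -
      have "H z $ i - H x $ i \<in> \<int>"
        using elim(2) eventually_nhds_x_imp_x[OF int] by simp
      moreover have "\<bar>H z $ i - H x $ i\<bar> < 1"
        using elim(1) component_le_norm_cart[of "H z - H x" i] by (simp add: dist_norm)
      ultimately show ?thesis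
        using Ints_nonzero_abs_less1 by fastforce
    qed
    then show ?case
      by (simp add: vec_eq_iff)
  qed
  have "((\<lambda>z. H x) has_derivative (\<lambda>v. M v - L v)) (at x)"
    using dH const eventually_nhds_x_imp_x[OF const]
    by (intro has_derivative_transform_eventually[OF dH])
       (auto simp: eventually_at_filter elim: eventually_mono)
  then have "(\<lambda>v. M v - L v) = (\<lambda>v. 0)"
    using has_derivative_const has_derivative_unique by blast
  then show ?thesis
    by (metis eq_iff_diff_eq_0 ext)
qed

lemma torus_deriv_eqI: "torus_has_derivative f L p \<Longrightarrow> torus_deriv f p = L"
  unfolding torus_deriv_def using torus_has_derivative_unique by blast

definition torus_C1_on :: "torus set \<Rightarrow> (torus \<Rightarrow> torus) \<Rightarrow> bool"
  where "torus_C1_on U f \<longleftrightarrow>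
    (\<exists>D :: torus \<Rightarrow> ((real^2) \<Rightarrow>\<^sub>L (real^2)).
       continuous_on U D \<and> (\<forall>p\<in>U. torus_has_derivative f (blinfun_apply (D p)) p))"

definition torus_C1_local_diffeo :: "(torus \<Rightarrow> torus) \<Rightarrow> bool"
  where "torus_C1_local_diffeo f \<longleftrightarrow>
    (\<forall>p. \<exists>U V. open U \<and> p \<in> U \<and> open V \<and> bij_betw f U V \<and>
           torus_C1_on U f \<and> torus_C1_on V (inv_into U f))"


section \<open>Cone families and partial hyperbolicity\<close>

text \<open>Quadratic forms on the tangent spaces are represented by their symmetric matrices.\<close>

definition quad_form :: "real^2^2 \<Rightarrow> real^2 \<Rightarrow> real"
  where "quad_form A v = v \<bullet> (A *v v)"

definition cone_family :: "(torus \<Rightarrow> (real^2) set) \<Rightarrow> bool"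
  where "cone_family C \<longleftrightarrow>
    (\<exists>Q :: torus \<Rightarrow> real^2^2.
       continuous_on UNIV Q \<and>
       (\<forall>p. transpose (Q p) = Q p \<and> det (Q p) \<noteq> 0 \<and>
            (\<exists>v. quad_form (Q p) v > 0) \<and> (\<exists>v. quad_form (Q p) v < 0) \<and>
            C p = {v. quad_form (Q p) v \<ge> 0}))"

definition cone_family_invariant :: "(torus \<Rightarrow> torus) \<Rightarrow> (torus \<Rightarrow> (real^2) set) \<Rightarrow> bool"
  where "cone_family_invariant f C \<longleftrightarrow>
    (\<forall>p. torus_deriv f p ` C p - {0} \<subseteq> interior (C (f p)))"

definition partially_hyperbolic_endo :: "(torus \<Rightarrow> torus) \<Rightarrow> bool"
  where "partially_hyperbolic_endo f \<longleftrightarrow>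
    torus_C1_local_diffeo f \<and>
    (\<exists>C k. cone_family C \<and> cone_family_invariant f C \<and> k > 0 \<and>
       (\<forall>p. \<forall>v\<in>C p. norm v = 1 \<longrightarrow> norm (torus_deriv (f ^^ k) p v) > 1))"

end

theory Submission
  imports Defs
begin

text \<open>
  The example is a skew product \<open>f (x, y) = (g x, 2 y + h x)\<close>, where \<open>g\<close> is a circle map of degree two
  and \<open>h\<close> is periodic. It is homotopic to multiplication by two because its lift differs from
  \<open>z \<mapsto> 2 z\<close> by a periodic map. With \<open>a = g'\<close> and \<open>s = h'\<close> the derivative sends \<open>(\<xi>, \<eta>)\<close> to
  \<open>(a \<xi>, s \<xi> + 2 \<eta>)\<close>. The vertical direction is invariant and is stretched by two, so a vector near
  the horizontal wins where \<open>a > 2\<close>, and the vertical direction wins where \<open>a < 2\<close>. Since \<open>a\<close> has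
  mean two, neither regime can hold on the whole circle. The map \<open>g\<close> gets two sinks, near
  which \<open>a = 1/10\<close>, and \<open>a > 6\<close> away from the two arcs around them.

  Away from the sinks the unstable cone is \<open>\<bar>\<eta>\<bar> \<le> \<bar>\<xi>\<bar>\<close>. Close to a sink it has to contain the
  vertical direction, so one of its edges must turn through the vertical on the way into the sink. The
  shear \<open>s\<close> makes this possible: if \<open>s\<close> is large and positive on an arc around a sink, then it pushes
  the lower edge \<open>\<eta> = - \<xi>\<close> strictly upwards although horizontal vectors are contracted there, and the
  upper edge can be let past the vertical as the arc falls into the sink. At a sink with \<open>s\<close> negative
  the roles of the two edges are exchanged.

  Two sinks with opposite shears are used because one does not suffice for cones that depend on \<open>x\<close>
  only. With a single sink one edge, say the lower one of slope \<open>\<mu> x\<close>, would stay away from the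
  vertical, and strict invariance would read \<open>2 \<mu> + s > a (\<mu> \<circ> g)\<close> on the whole circle. Both sides have the same integral, because \<open>s\<close> has mean
  zero and \<open>g\<close> has degree two, so this is impossible. When each edge turns through the vertical
  somewhere, the obstruction disappears, and \<open>h x = - (20 / \<pi>) cos (2 \<pi> x)\<close> with
  \<open>s x = 40 sin (2 \<pi> x)\<close> serves for sinks at \<open>1/4\<close> and \<open>3/4\<close>.

  The circle map is constructed in \<open>exists_circle_map_two_sinks\<close>; \<open>skew_cone_step\<close> is the invariance
  and the expansion of the cones, which already holds after one step; and
  \<open>torus_C1_local_diffeo_torus_map\<close> and \<open>homotopic_torus_map\<close> transfer statements about periodic lifts
  to the torus.
\<close>

section \<open>The torus as a covering quotient\<close>

lemma torus_proj_rep [simp]: "torus_proj (torus_rep p) = p"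
  using Quotient3_abs_rep[OF Quotient3_torus] .

lemma torus_rel_rep_proj: "torus_rel (torus_rep (torus_proj z)) z"
  using torus.abs_eq_iff torus_proj_rep by blast

lemma torus_proj_eq_iff_rel: "torus_proj x = torus_proj y \<longleftrightarrow> torus_rel x y"
  by (rule torus.abs_eq_iff)

lemma torus_proj_surj: "\<exists>z. p = torus_proj z"
  by (metis torus_proj_rep)

lemma continuous_on_torus_proj: "continuous_on S torus_proj"
proof -
  have "open (torus_proj -` B)" if "open B" for B
    using that by (simp add: open_torus_def)
  then have "continuous_on UNIV torus_proj"
    by (simp add: continuous_on_open_vimage)
  then show ?thesis
    using continuous_on_subset by blast
qed

text \<open>
  The projection is a quotient map by a group of translations, so the saturation of an open set is a
  union of translates. Openness of the projection is what makes products with it and its restrictions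
  to small sets quotient maps as well.
\<close>

lemma open_image_torus_proj:
  assumes "open A"
  shows "open (torus_proj ` A)"
proof -
  have "torus_proj -` (torus_proj ` A) = (\<Union>n\<in>{n. \<forall>i. n $ i \<in> \<int>}. (+) n ` A)"
  proof (intro equalityI subsetI)
    fix z assume "z \<in> torus_proj -` (torus_proj ` A)"
    then obtain a where "a \<in> A" and "torus_proj z = torus_proj a"
      by auto
    then have "z = (z - a) + a" "\<forall>i. (z - a) $ i \<in> \<int>" 
      by (auto simp: torus_proj_eq_iff)
    with \<open>a \<in> A\<close> show "z \<in> (\<Union>n\<in>{n. \<forall>i. n $ i \<in> \<int>}. (+) n ` A)"
      by blast
  next
    fix z assume "z \<in> (\<Union>n\<in>{n. \<forall>i. n $ i \<in> \<int>}. (+) n ` A)"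
    then obtain n a where "\<forall>i. n $ i \<in> \<int>" "a \<in> A" "z = n + a"
      by auto
    then have "torus_proj z = torus_proj a"
      by (simp add: torus_proj_eq_iff)
    with \<open>a \<in> A\<close> show "z \<in> torus_proj -` (torus_proj ` A)"
      by auto
  qed
  moreover have "open ((+) n ` A)" for n
    using assms by (rule open_translation)
  ultimately show ?thesis
    by (auto simp: open_torus_def)
qed

lemma continuous_on_descend:
  fixes d :: "real^2 \<Rightarrow> 'a::topological_space"
  assumes "continuous_on UNIV d" and rel: "\<And>z w. torus_rel z w \<Longrightarrow> d z = d w"
  shows "continuous_on S (\<lambda>p. d (torus_rep p))"
proof -
  have "open ((\<lambda>p. d (torus_rep p)) -` B)" if "open B" for B
  proof -
    have "torus_proj -` ((\<lambda>p. d (torus_rep p)) -` B) = d -` B"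
      using rel[OF torus_rel_rep_proj] by auto
    moreover have "open (d -` B)"
      using assms(1) \<open>open B\<close> by (simp add: continuous_on_open_vimage)
    ultimately show ?thesis
      by (simp add: open_torus_def)
  qed
  then have "continuous_on UNIV (\<lambda>p. d (torus_rep p))"
    by (simp add: continuous_on_open_vimage)
  then show ?thesis
    using continuous_on_subset by blast
qed

lemma torus_rel_close_imp_eq:
  assumes "torus_rel x y" and "dist x y < 1"
  shows "x = y"
proof -
  have "x $ i = y $ i" for i
  proof -
    have "x $ i - y $ i \<in> \<int>"
      using assms(1) by (simp add: torus_rel_def)
    moreover have "\<bar>x $ i - y $ i\<bar> < 1"
      using assms(2) component_le_norm_cart[of "x - y" i] by (simp add: dist_norm)
    ultimately show ?thesis
      using Ints_nonzero_abs_less1 by fastforce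
  qed
  then show ?thesis
    by (simp add: vec_eq_iff)
qed

text \<open>
  Distinct representatives of one point of the torus are at distance at least one.
\<close>

lemma inj_on_torus_proj_ball: "inj_on torus_proj (ball z (1/2))"
proof (rule inj_onI)
  fix x y assume "x \<in> ball z (1/2)" "y \<in> ball z (1/2)" "torus_proj x = torus_proj y"
  moreover from this have "dist x y < 1"
    using dist_triangle_half_r[of z x 1 y] by (simp add: dist_commute)
  ultimately show "x = y"
    by (simp add: torus_proj_eq_iff_rel torus_rel_close_imp_eq)
qed

text \<open>
  Local sections of the covering: they carry derivatives of local inverses, which are not periodic
  functions on the plane, to the torus.
\<close>

lemma continuous_on_inv_into_torus_proj:
  assumes "open W" and inj: "inj_on torus_proj W"
  shows "continuous_on (torus_proj ` W) (inv_into W torus_proj)"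
proof (rule continuous_on_inverse_open_map)
  show "continuous_on W torus_proj"
    by (rule continuous_on_torus_proj)
  show "inv_into W torus_proj (torus_proj x) = x" if "x \<in> W" for x
    using inj that by simp
  show "openin (top_of_set (torus_proj ` W)) (torus_proj ` U)" if "openin (top_of_set W) U" for U
  proof -
    have "open U" "U \<subseteq> W"
      using that \<open>open W\<close> openin_open_eq by blast+
    then show ?thesis
      using open_image_torus_proj[OF \<open>open W\<close>] by (simp add: openin_open_eq open_image_torus_proj image_mono)
  qed
qed simp

section \<open>Maps of the torus given by lifts\<close>

definition torus_map :: "(real^2 \<Rightarrow> real^2) \<Rightarrow> torus \<Rightarrow> torus"
  where "torus_map F p = torus_proj (F (torus_rep p))"

lemma torus_map_proj:
  assumes "\<And>z w. torus_rel z w \<Longrightarrow> torus_rel (F z) (F w)"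
  shows "torus_map F (torus_proj z) = torus_proj (F z)"
  using assms[OF torus_rel_rep_proj] by (simp add: torus_map_def torus_proj_eq_iff_rel)

lemma torus_has_derivative_torus_map:
  assumes "\<And>z w. torus_rel z w \<Longrightarrow> torus_rel (F z) (F w)" and "(F has_derivative L) (at z)"
  shows "torus_has_derivative (torus_map F) L (torus_proj z)"
  unfolding torus_has_derivative_def
  using assms by (intro exI[of _ z] exI[of _ F]) (simp add: torus_map_proj)

text \<open>
  The inverse function theorem is applied to the lift on a neighbourhood so small that it and its image
  both project injectively. The derivative of the local inverse at a point is \<open>E\<close> at its preimage, and
  is therefore continuous.
\<close>

lemma torus_C1_local_diffeo_torus_map:
  fixes F :: "real^2 \<Rightarrow> real^2" and F' E :: "real^2 \<Rightarrow> ((real^2) \<Rightarrow>\<^sub>L (real^2))"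
  assumes rel: "\<And>z w. torus_rel z w \<Longrightarrow> torus_rel (F z) (F w)"
    and rel': "\<And>z w. torus_rel z w \<Longrightarrow> F' z = F' w"
    and der: "\<And>z. (F has_derivative blinfun_apply (F' z)) (at z)"
    and cont: "continuous_on UNIV F'"
    and E: "\<And>z. E z o\<^sub>L F' z = id_blinfun"
    and contE: "continuous_on UNIV E"
  shows "torus_C1_local_diffeo (torus_map F)"
  unfolding torus_C1_local_diffeo_def
proof
  fix p
  define z0 where "z0 = torus_rep p"
  have contF: "continuous_on UNIV F"
    by (intro continuous_at_imp_continuous_on ballI has_derivative_continuous[OF der])
  \<comment> \<open>Radius one half makes the projection injective on the ball, in the source and in the target.\<close>
  define N where "N = ball z0 (1/2) \<inter> F -` ball (F z0) (1/2)"
  have "open N"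
    using contF unfolding N_def by (intro open_Int open_ball) (simp add: continuous_on_open_vimage)
  moreover have "continuous_on N F'"
    using cont continuous_on_subset by blast
  moreover have "z0 \<in> N"
    by (simp add: N_def)
  ultimately obtain U V G G' where
    U: "open U" "U \<subseteq> N" "z0 \<in> U" and V: "open V" "F z0 \<in> V" and hom: "homeomorphism U V F G"
    and derG: "\<And>y. y \<in> V \<Longrightarrow> (G has_derivative (G' y)) (at y)"
    and G': "\<And>y. y \<in> V \<Longrightarrow> G' y = inv (blinfun_apply (F' (G y)))"
    and bijF': "\<And>y. y \<in> V \<Longrightarrow> bij (blinfun_apply (F' (G y)))"
    by (rule inverse_function_theorem[OF _ der _ _ E]) (rule that, assumption+)
  have FU: "F ` U = V" and GF: "\<And>x. x \<in> U \<Longrightarrow> G (F x) = x" and FG: "\<And>y. y \<in> V \<Longrightarrow> F (G y) = y"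
    and GV: "G ` V = U" and contG: "continuous_on V G"
    using hom by (auto simp: homeomorphism_def)
  have injU: "inj_on torus_proj U"
    using U(2) inj_on_torus_proj_ball[of z0] by (auto simp: N_def intro: inj_on_subset)
  have "V \<subseteq> ball (F z0) (1/2)"
    using U(2) FU by (auto simp: N_def)
  then have injV: "inj_on torus_proj V"
    using inj_on_torus_proj_ball inj_on_subset by blast
  have f: "torus_map F (torus_proj z) = torus_proj (F z)" for z
    by (rule torus_map_proj[OF rel])
  have bij: "bij_betw (torus_map F) (torus_proj ` U) (torus_proj ` V)"
  proof (rule bij_betw_imageI)
    show "inj_on (torus_map F) (torus_proj ` U)"
    proof (rule inj_onI, clarsimp simp: f)
      fix x y assume "x \<in> U" "y \<in> U" "torus_proj (F x) = torus_proj (F y)"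
      moreover from this have "F x = F y"
        using injV FU by (auto dest: inj_onD)
      ultimately show "torus_proj x = torus_proj y"
        using GF by metis
    qed
    show "torus_map F ` torus_proj ` U = torus_proj ` V"
      using FU by (auto simp: f image_image)
  qed
  have "torus_C1_on (torus_proj ` U) (torus_map F)"
    unfolding torus_C1_on_def
  proof (intro exI[of _ "\<lambda>p. F' (torus_rep p)"] conjI ballI)
    show "continuous_on (torus_proj ` U) (\<lambda>p. F' (torus_rep p))"
      by (rule continuous_on_descend[OF cont rel'])
    fix q
    show "torus_has_derivative (torus_map F) (blinfun_apply (F' (torus_rep q))) q"
      using torus_has_derivative_torus_map[OF rel der, of "torus_rep q"] by simp
  qed
  moreover have "torus_C1_on (torus_proj ` V) (inv_into (torus_proj ` U) (torus_map F))"
    unfolding torus_C1_on_def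
  proof (intro exI[of _ "\<lambda>q. E (G (inv_into V torus_proj q))"] conjI ballI)
    have "continuous_on (torus_proj ` V) (\<lambda>q. G (inv_into V torus_proj q))"
      using continuous_on_inv_into_torus_proj[OF V(1) injV]
      by (rule continuous_on_compose2[OF contG]) (simp add: inv_into_into image_subset_iff)
    then show "continuous_on (torus_proj ` V) (\<lambda>q. E (G (inv_into V torus_proj q)))"
      by (rule continuous_on_compose2[OF contE]) auto
    fix q assume "q \<in> torus_proj ` V"
    then obtain y where y: "y \<in> V" "q = torus_proj y"
      by auto
    have inv: "torus_proj (G z) = inv_into (torus_proj ` U) (torus_map F) (torus_proj z)" if "z \<in> V" for z
    proof -
      have "G z \<in> U"
        using that GV by auto
      then have "inv_into (torus_proj ` U) (torus_map F) (torus_map F (torus_proj (G z))) = torus_proj (G z)"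
        using bij by (intro inv_into_f_f) (auto simp: bij_betw_def)
      then show ?thesis
        using that by (simp add: f FG)
    qed
    have "blinfun_apply (E (G y)) (blinfun_apply (F' (G y)) v) = v" for v
      by (metis E blinfun_apply_blinfun_compose blinfun_apply_id_blinfun)
    then have "inv (blinfun_apply (F' (G y))) = blinfun_apply (E (G y))"
      using bij_is_surj[OF bijF'[OF y(1)]] by (intro inv_unique_comp) (auto simp: fun_eq_iff surj_def, metis)
    then have "(G has_derivative blinfun_apply (E (G y))) (at y)"
      using derG[OF y(1)] G'[OF y(1)] by simp
    moreover have "\<forall>\<^sub>F z in nhds y. torus_proj (G z) = inv_into (torus_proj ` U) (torus_map F) (torus_proj z)"
      using eventually_nhds_in_open[OF V(1) y(1)] by eventually_elim (rule inv)
    moreover have "inv_into V torus_proj q = y"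
      using y injV by simp
    ultimately show "torus_has_derivative (inv_into (torus_proj ` U) (torus_map F)) (blinfun_apply (E (G (inv_into V torus_proj q)))) q"
      unfolding torus_has_derivative_def using y(2) by auto
  qed
  moreover have "p \<in> torus_proj ` U"
    using U(3) by (simp add: z0_def image_iff) (metis torus_proj_rep)
  ultimately show "\<exists>U V. open U \<and> p \<in> U \<and> open V \<and> bij_betw (torus_map F) U V \<and>
           torus_C1_on U (torus_map F) \<and> torus_C1_on V (inv_into U (torus_map F))"
    using bij U(1) V(1) open_image_torus_proj by blast
qed

lemma open_image_id_torus_proj:
  fixes A :: "('a::topological_space \<times> (real^2)) set"
  assumes "open A"
  shows "open (map_prod id torus_proj ` A)"
  unfolding open_prod_def
proof
  fix q assume "q \<in> map_prod id torus_proj ` A"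
  then obtain r where r: "q = map_prod id torus_proj r" "r \<in> A"
    by (rule imageE)
  obtain t z where "r = (t, z)"
    by (rule prod.exhaust)
  with r have "(t, z) \<in> A" "q = (t, torus_proj z)"
    by simp_all
  from open_prod_elim[OF assms \<open>(t, z) \<in> A\<close>] obtain B C where "open B" "open C" "t \<in> B" "z \<in> C" "B \<times> C \<subseteq> A"
    by (metis mem_Sigma_iff)
  moreover from this have "map_prod id torus_proj ` (B \<times> C) \<subseteq> map_prod id torus_proj ` A"
    by (intro image_mono)
  ultimately have "open (torus_proj ` C)" "q \<in> B \<times> torus_proj ` C" "B \<times> torus_proj ` C \<subseteq> map_prod id torus_proj ` A"
    using \<open>q = (t, torus_proj z)\<close> by (simp_all add: open_image_torus_proj map_prod_surj_on)
  with \<open>open B\<close> show "\<exists>A' B'. open A' \<and> open B' \<and> q \<in> A' \<times> B' \<and> A' \<times> B' \<subseteq> map_prod id torus_proj ` A"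
    by blast
qed

lemma homotopic_with_canonI:
  fixes H :: "real \<times> 'a::topological_space \<Rightarrow> 'b::topological_space"
  assumes "continuous_on ({0..1} \<times> UNIV) H" and "\<And>p. H (0, p) = f p" and "\<And>p. H (1, p) = g p"
  shows "homotopic_with_canon (\<lambda>_. True) UNIV UNIV f g"
proof -
  have "continuous_map (prod_topology (top_of_set {0..1}) (top_of_set UNIV)) (top_of_set UNIV) H"
    using assms(1) unfolding subtopology_Times[symmetric]
    by (simp only: subtopology_UNIV prod_topology_euclidean continuous_map_iff_continuous)
  then show ?thesis
    unfolding homotopic_with_def using assms(2,3) by (intro exI[of _ H] conjI allI ballI TrueI)
qed

text \<open>
  The segment between two lifts with the same deck transformation behaviour consists of lifts, so it
  descends to a homotopy; continuity descends because the projection times the identity is open.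
\<close>

lemma homotopic_torus_map:
  fixes F G :: "real^2 \<Rightarrow> real^2"
  assumes contF: "continuous_on UNIV F" and contG: "continuous_on UNIV G"
    and relF: "\<And>z w. torus_rel z w \<Longrightarrow> torus_rel (F z) (F w)"
    and rel: "\<And>z w. torus_rel z w \<Longrightarrow> F z - F w = G z - G w"
  shows "homotopic_with_canon (\<lambda>_. True) UNIV UNIV (torus_map F) (torus_map G)"
proof -
  define K where "K = (\<lambda>(t::real, z). F z + t *\<^sub>R (G z - F z))"
  define H where "H = (\<lambda>(t, p). torus_proj (K (t, torus_rep p)))"
  have H: "H (map_prod id torus_proj q) = torus_proj (K q)" for q
  proof -
    obtain t z where q: "q = (t, z)"
      by (rule prod.exhaust)
    let ?w = "torus_rep (torus_proj z)"
    have "K (t, ?w) - K (t, z) = (F ?w - F z) + t *\<^sub>R ((G ?w - G z) - (F ?w - F z))"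
      by (simp add: K_def algebra_simps)
    then have "K (t, ?w) - K (t, z) = F ?w - F z"
      using rel[OF torus_rel_rep_proj[of z]] by simp
    then have "K (t, ?w) $ i - K (t, z) $ i = F ?w $ i - F z $ i" for i
      by (metis vector_minus_component)
    then have "torus_rel (K (t, ?w)) (K (t, z))"
      using relF[OF torus_rel_rep_proj[of z]] by (simp add: torus_rel_def)
    then show ?thesis
      by (simp add: q H_def torus_proj_eq_iff_rel)
  qed
  have "continuous_on UNIV (\<lambda>q::real \<times> (real^2). F (snd q))" "continuous_on UNIV (\<lambda>q::real \<times> (real^2). G (snd q))"
    by (rule continuous_on_compose2[OF contF] continuous_on_compose2[OF contG], intro continuous_intros, simp)+
  then have "continuous_on UNIV K"
    unfolding K_def case_prod_beta by (intro continuous_intros)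
  then have contpK: "continuous_on UNIV (\<lambda>q. torus_proj (K q))"
    by (rule continuous_on_compose2[OF continuous_on_torus_proj[of UNIV]]) auto
  have "open (H -` B)" if "open B" for B
  proof -
    have "H -` B = map_prod id torus_proj ` ((\<lambda>q. torus_proj (K q)) -` B)"
    proof (intro equalityI subsetI)
      fix q assume "q \<in> H -` B"
      moreover obtain t z where "q = map_prod id torus_proj (t, z)"
        by (rule that[of "fst q" "torus_rep (snd q)"]) (simp add: map_prod_def case_prod_beta)
      ultimately show "q \<in> map_prod id torus_proj ` ((\<lambda>q. torus_proj (K q)) -` B)"
        using H[of "(t, z)"] by (intro image_eqI[of _ _ "(t, z)"]) simp_all
    next
      fix q assume "q \<in> map_prod id torus_proj ` ((\<lambda>q. torus_proj (K q)) -` B)"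
      then obtain r where "q = map_prod id torus_proj r" "r \<in> (\<lambda>q. torus_proj (K q)) -` B"
        by (rule imageE)
      then show "q \<in> H -` B"
        using H[of r] by simp
    qed
    moreover have "open ((\<lambda>q. torus_proj (K q)) -` B)"
      using contpK \<open>open B\<close> by (simp add: continuous_on_open_vimage)
    ultimately show ?thesis
      by (simp add: open_image_id_torus_proj)
  qed
  then have "continuous_on UNIV H"
    by (simp add: continuous_on_open_vimage)
  then have "continuous_on ({0..1} \<times> UNIV) H"
    using continuous_on_subset by blast
  moreover have "H (0, p) = torus_map F p" "H (1, p) = torus_map G p" for p
    by (simp_all add: H_def K_def torus_map_def)
  ultimately show ?thesis
    by (rule homotopic_with_canonI)
qed

section \<open>A circle map of degree two with two sinks\<close>

lemma shift_of_int:
  fixes f :: "real \<Rightarrow> real"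
  assumes "\<And>x. f (x + 1) = f x + c"
  shows "f (x + of_int n) = f x + c * of_int n"
proof (induction n rule: int_induct[where k = 0])
  case (step1 i)
  then show ?case
    using assms[of "x + of_int i"] by (simp add: algebra_simps)
next
  case (step2 i)
  then show ?case
    using assms[of "x + of_int (i - 1)"] by (simp add: algebra_simps)
qed simp

lemma odd_antiderivative:
  fixes f :: "real \<Rightarrow> real"
  assumes "continuous_on UNIV f" and even: "\<And>x. f (- x) = f x"
  obtains F where "\<And>x. (F has_real_derivative f x) (at x)" and "\<And>x. F (- x) = - F x"
proof -
  have "\<exists>F. \<forall>x::real. - \<infinity> < ereal x \<longrightarrow> ereal x < \<infinity> \<longrightarrow> (F has_vector_derivative f x) (at x)"
    using assms(1) by (intro einterval_antiderivative) (simp_all add: continuous_on_eq_continuous_at)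
  then obtain H where H: "\<And>x. (H has_real_derivative f x) (at x)"
    by (auto simp: has_real_derivative_iff_has_vector_derivative)
  define F where "F x = H x - H 0" for x
  have F: "(F has_real_derivative f x) (at x)" for x
    unfolding F_def by (auto intro!: derivative_eq_intros H)
  have "((\<lambda>x. F (- x) + F x) has_real_derivative 0) (at x)" for x
    by (auto intro!: derivative_eq_intros F DERIV_chain2[OF F] simp: even)
  then have "F (- x) + F x = F (- 0) + F 0" for x
    by (rule DERIV_isconst_all[rule_format])
  moreover have "F 0 = 0"
    by (simp add: F_def)
  ultimately have "F (- x) = - F x" for x
    by (simp add: eq_neg_iff_add_eq_0)
  with F that show thesis
    by blast
qed

definition bump :: "real \<Rightarrow> real"
  where "bump t = max 0 (min 1 (11 - 100 * \<bar>t\<bar>))"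

lemma continuous_on_bump: "continuous_on S bump"
  unfolding bump_def by (intro continuous_intros)

lemma bump_minus [simp]: "bump (- t) = bump t"
  by (simp add: bump_def)

lemma bump_nonneg: "0 \<le> bump t" and bump_le_1: "bump t \<le> 1"
  by (simp_all add: bump_def)

lemma bump_eq_1: "\<bar>t\<bar> \<le> 1/10 \<Longrightarrow> bump t = 1"
  by (simp add: bump_def)

lemma bump_eq_0: "11/100 \<le> \<bar>t\<bar> \<Longrightarrow> bump t = 0"
  by (simp add: bump_def)

lemma sin_2pi_reflect: "sin (2 * pi * (1/2 - x)) = sin (2 * pi * x)"
proof -
  have "2 * pi * (1/2 - x) = pi - 2 * pi * x"
    by (simp add: field_simps)
  then show ?thesis
    by (simp add: sin_diff)
qed

text \<open>
  The derivative is \<open>a = 1/10 + bump (sin 2\<pi>x) (\<kappa> - \<mu> cos 2\<pi>x)\<close>. The bump lives on short arcs around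
  \<open>0\<close> and \<open>1/2\<close>, where the cosine is close to \<open>1\<close> and \<open>- 1\<close>, so the two parameters \<open>\<kappa>\<close> and \<open>\<mu>\<close>
  control the total growth over the two arcs independently. They are determined by requiring degree
  two and \<open>g (1/4) = 1/4\<close>; the second sink at \<open>3/4\<close> then comes for free, since \<open>g\<close> is odd. The odd
  antiderivative of \<open>bump (sin 2\<pi>x) cos 2\<pi>x\<close> is \<open>\<Phi> (sin 2\<pi>x) / 2\<pi>\<close> with \<open>\<Phi>' = bump\<close>, while the
  antiderivative \<open>G\<close> of \<open>bump (sin 2\<pi>x)\<close> has no closed form. It is controlled by \<open>\<Phi>\<close> because the cosine
  lies between \<open>9/10\<close> and \<open>1\<close> in absolute value where the bump does not vanish.

  The last two properties say that the arcs \<open>\<bar>sin 2\<pi>x\<bar> \<ge> 1/10\<close> are mapped well inside themselves. Apart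
  from the slope \<open>1/10\<close>, the growth of \<open>g\<close> over such an arc happens only on the narrow ramps of the bump
  at the two ends.
\<close>

lemma exists_circle_map_two_sinks:
  obtains g a :: "real \<Rightarrow> real" where
    "\<And>x. (g has_real_derivative a x) (at x)" and "continuous_on UNIV a"
    and "\<And>x. g (x + 1) = g x + 2" and "\<And>x. a (x + 1) = a x"
    and "\<And>x. 0 < a x"
    and "\<And>x. \<bar>sin (2 * pi * x)\<bar> \<le> 1/10 \<Longrightarrow> 6 < a x"
    and "\<And>x. 11/100 \<le> \<bar>sin (2 * pi * x)\<bar> \<Longrightarrow> a x = 1/10"
    and "\<And>x. 1/10 \<le> sin (2 * pi * x) \<Longrightarrow> 12/100 \<le> sin (2 * pi * g x)"
    and "\<And>x. sin (2 * pi * x) \<le> - 1/10 \<Longrightarrow> sin (2 * pi * g x) \<le> - 12/100"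
proof -
  let ?S = "\<lambda>x. sin (2 * pi * x)" and ?C = "\<lambda>x. cos (2 * pi * x)"
  have "continuous_on UNIV (\<lambda>x. bump (?S x))"
    by (rule continuous_on_compose2[OF continuous_on_bump[of UNIV]]) (auto intro!: continuous_intros)
  then obtain G where G: "\<And>x. (G has_real_derivative bump (?S x)) (at x)" and G_odd: "\<And>x. G (- x) = - G x"
    by (rule odd_antiderivative) auto
  obtain \<Phi> where \<Phi>: "\<And>t. (\<Phi> has_real_derivative bump t) (at t)" and \<Phi>_odd: "\<And>t. \<Phi> (- t) = - \<Phi> t"
    using odd_antiderivative[OF continuous_on_bump] by auto
  have \<Phi>S: "((\<lambda>x. \<Phi> (?S x)) has_real_derivative bump (?S x) * (2 * pi * ?C x)) (at x)" for x
    by (rule DERIV_chain2[OF \<Phi>]) (auto intro!: derivative_eq_intros)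
  have zero: "G 0 = 0" "\<Phi> 0 = 0"
    using G_odd[of 0] \<Phi>_odd[of 0] by simp_all
  \<comment> \<open>\<open>w\<close> is the mass of the bump on one of the two arcs, and \<open>\<phi>\<close> is half of its mass in the variable \<open>sin 2\<pi>x\<close>.\<close>
  define w where "w = 2 * G (1/4)"
  define \<phi> where "\<phi> = \<Phi> 1"
  have pi3: "3 < pi"
    using pi_gt3 .

  have \<Phi>_const: "\<Phi> t = \<phi>" if "11/100 \<le> t" "t \<le> 1" for t
  proof (rule ccontr)
    assume ne: "\<Phi> t \<noteq> \<phi>"
    then have "t < 1"
      using that by (cases "t = 1") (auto simp: \<phi>_def)
    then obtain z where "t < z" "z < 1" "\<Phi> 1 - \<Phi> t = (1 - t) * bump z"
      using MVT2[of t 1 \<Phi> bump] \<Phi> by blast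
    with that ne show False
      by (simp add: bump_eq_0 \<phi>_def)
  qed
  have \<Phi>_mono: "\<Phi> s \<le> \<Phi> t" if "s \<le> t" for s t
    using that by (rule DERIV_nonneg_imp_nondecreasing) (use \<Phi> bump_nonneg in blast)
  have \<Phi>_lip: "\<Phi> t - \<Phi> s \<le> t - s" if "s \<le> t" for s t
  proof -
    have "t - \<Phi> t \<ge> s - \<Phi> s"
      using that
    proof (rule DERIV_nonneg_imp_nondecreasing[where f = "\<lambda>t. t - \<Phi> t"])
      fix x
      have "((\<lambda>t. t - \<Phi> t) has_real_derivative 1 - bump x) (at x)"
        by (auto intro!: derivative_eq_intros \<Phi>)
      then show "\<exists>y. ((\<lambda>t. t - \<Phi> t) has_real_derivative y) (at x) \<and> 0 \<le> y"
        using bump_le_1[of x] by (intro exI[of _ "1 - bump x"]) simp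
    qed
    then show ?thesis
      by simp
  qed
  have "1/10 \<le> \<Phi> (1/10)"
  proof -
    obtain z where "0 < z" "z < 1/10" "\<Phi> (1/10) - \<Phi> 0 = (1/10 - 0) * bump z"
      using MVT2[of 0 "1/10" \<Phi> bump] \<Phi> by auto
    then show ?thesis
      by (simp add: bump_eq_1 zero)
  qed
  then have \<Phi>_ge: "1/10 \<le> \<Phi> t" if "1/10 \<le> t" for t
    using \<Phi>_mono[OF that] by simp
  have \<phi>_ge: "1/10 \<le> \<phi>"
    using \<Phi>_ge[of 1] by (simp add: \<phi>_def)
  have \<phi>_le: "\<phi> \<le> 11/100"
    using \<Phi>_lip[of 0 "11/100"] \<Phi>_const[of "11/100"] by (simp add: zero)
  have \<phi>_diff: "\<phi> - \<Phi> t \<le> 1/100" if "1/10 \<le> t" for t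
  proof (cases "t \<le> 11/100")
    case True
    then show ?thesis
      using \<Phi>_lip[of t "11/100"] \<Phi>_const[of "11/100"] that by simp
  next
    case False
    then show ?thesis
      using \<Phi>_mono[of "11/100" t] \<Phi>_const[of "11/100"] by simp
  qed

  have cos_ge: "9/10 \<le> ?C x" if "\<bar>?S x\<bar> < 11/100" "0 \<le> ?C x" for x
  proof (rule power2_le_imp_le[OF _ that(2)])
    have "(?S x)\<^sup>2 \<le> (11/100)\<^sup>2"
      using that(1) by (metis abs_le_square_iff abs_of_nonneg less_eq_real_def zero_le_divide_iff zero_le_numeral)
    then show "(9/10)\<^sup>2 \<le> (?C x)\<^sup>2"
      using sin_cos_squared_add[of "2 * pi * x"] by (simp add: power2_eq_square)
  qed
  \<comment> \<open>The cosine is at most \<open>1\<close>, which bounds \<open>w\<close> from below.\<close>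
  have "G 0 - \<Phi> (?S 0) / (2 * pi) \<le> G (1/4) - \<Phi> (?S (1/4)) / (2 * pi)"
  proof (rule DERIV_nonneg_imp_nondecreasing[where f = "\<lambda>x. G x - \<Phi> (?S x) / (2 * pi)"])
    fix x
    have "((\<lambda>x. G x - \<Phi> (?S x) / (2 * pi)) has_real_derivative bump (?S x) * (1 - ?C x)) (at x)"
      by (rule DERIV_cong[OF DERIV_diff[OF G DERIV_cdivide[OF \<Phi>S]]]) (simp add: field_simps)
    moreover have "0 \<le> bump (?S x) * (1 - ?C x)"
      by (simp add: bump_nonneg)
    ultimately show "\<exists>y. ((\<lambda>x. G x - \<Phi> (?S x) / (2 * pi)) has_real_derivative y) (at x) \<and> 0 \<le> y"
      by blast
  qed simp
  moreover have S_quarter: "?S (1/4) = 1"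
    by (simp add: field_simps)
  ultimately have w_ge: "\<phi> / pi \<le> w"
    by (simp add: zero w_def \<phi>_def)
  \<comment> \<open>Where the bump does not vanish on \<open>[0, 1/4]\<close>, the cosine is at least \<open>9/10\<close>: a bound from above for \<open>w\<close> and for the mass beyond \<open>x\<close>.\<close>
  have upper: "w / 2 - G x \<le> (\<phi> - \<Phi> (?S x)) / (9/5 * pi)" if "0 \<le> x" "x \<le> 1/4" for x
  proof -
    have "G (1/4) - \<Phi> (?S (1/4)) / (9/5 * pi) \<le> G x - \<Phi> (?S x) / (9/5 * pi)"
      using that(2)
    proof (rule DERIV_nonpos_imp_nonincreasing[where f = "\<lambda>x. G x - \<Phi> (?S x) / (9/5 * pi)"])
      fix y assume y: "x \<le> y" "y \<le> 1/4"
      have "((\<lambda>x. G x - \<Phi> (?S x) / (9/5 * pi)) has_real_derivative bump (?S y) * (1 - 10/9 * ?C y)) (at y)"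
        by (rule DERIV_cong[OF DERIV_diff[OF G DERIV_cdivide[OF \<Phi>S]]]) (simp add: field_simps)
      moreover have "bump (?S y) * (1 - 10/9 * ?C y) \<le> 0"
      proof (cases "\<bar>?S y\<bar> < 11/100")
        case True
        moreover have "0 \<le> ?C y"
        proof (rule cos_ge_zero)
          have "0 \<le> 2 * pi * y"
            using y that(1) by simp
          then show "- (pi / 2) \<le> 2 * pi * y"
            using pi_gt_zero by linarith
          show "2 * pi * y \<le> pi / 2"
            using y by (simp add: field_simps)
        qed
        ultimately show ?thesis
          using cos_ge[of y] bump_nonneg[of "?S y"] by (simp add: mult_nonneg_nonpos)
      qed (simp add: bump_eq_0)
      ultimately show "\<exists>z. ((\<lambda>x. G x - \<Phi> (?S x) / (9/5 * pi)) has_real_derivative z) (at y) \<and> z \<le> 0"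
        by blast
    qed
    then show ?thesis
      by (simp add: S_quarter w_def \<phi>_def diff_divide_distrib)
  qed
  have w_le: "w \<le> \<phi> / (9/10 * pi)"
    using upper[of 0] by (simp add: zero field_simps)
  have w_pos: "0 < w"
    using w_ge \<phi>_ge pi_gt_zero by (smt (verit) divide_pos_pos)

  have G_reflect: "G x + G (1/2 - x) = w" for x
  proof -
    have "((\<lambda>x. G x + G (1/2 - x)) has_real_derivative 0) (at x)" for x
      by (auto intro!: derivative_eq_intros G DERIV_chain2[OF G] simp: sin_2pi_reflect)
    then have "G x + G (1/2 - x) = G (1/4) + G (1/2 - 1/4)"
      by (rule DERIV_isconst_all[rule_format])
    then show ?thesis
      by (simp add: w_def)
  qed
  have G_half: "G (x + 1/2) = G x + w" for x
    using G_reflect[of "- x"] G_odd[of x] by (simp add: add.commute)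
  have G_shift: "G (x + 1) = G x + 2 * w" for x
    using G_half[of x] G_half[of "x + 1/2"] by (simp add: add.commute)

  \<comment> \<open>Degree two means \<open>1/10 + 2 \<kappa> w = 2\<close>, and \<open>g (1/4) = 1/4\<close> then means \<open>\<mu> \<phi> = \<pi> / 2\<close>.\<close>
  define \<kappa> where "\<kappa> = 19/20 / w"
  define \<mu> where "\<mu> = pi / (2 * \<phi>)"
  define g where "g x = x / 10 + \<kappa> * G x - \<mu> * \<Phi> (?S x) / (2 * pi)" for x
  define a where "a x = 1/10 + bump (?S x) * (\<kappa> - \<mu> * ?C x)" for x
  have \<kappa>w: "\<kappa> * w = 19/20"
    using w_pos by (simp add: \<kappa>_def)
  have \<mu>\<Phi>: "\<mu> * t / (2 * pi) = t / (4 * \<phi>)" for t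
    using \<phi>_ge by (simp add: \<mu>_def field_simps)
  have \<kappa>_pos: "0 < \<kappa>"
    using w_pos by (simp add: \<kappa>_def)
  have \<mu>_pos: "0 < \<mu>"
    using \<phi>_ge by (simp add: \<mu>_def)
  have gap: "6 < \<kappa> - \<mu>"
  proof -
    have "19/20 / (\<phi> / (9/10 * pi)) \<le> \<kappa>"
      unfolding \<kappa>_def using w_le w_pos by (intro divide_left_mono mult_pos_pos) (use \<phi>_ge in auto)
    then have "355/1000 * (pi / \<phi>) \<le> \<kappa> - \<mu>"
      by (simp add: \<mu>_def field_simps)
    moreover have "3 / (11/100) \<le> pi / \<phi>"
      using pi3 \<phi>_ge \<phi>_le by (intro frac_le) auto
    ultimately show ?thesis
      by simp
  qed
  have gap_le: "\<kappa> - \<mu> \<le> \<kappa> - \<mu> * ?C x" for x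
    using \<mu>_pos by simp

  have deriv: "(g has_real_derivative a x) (at x)" for x
    unfolding g_def a_def
    by (rule DERIV_cong[OF DERIV_diff[OF DERIV_add[OF DERIV_cdivide[OF DERIV_ident] DERIV_cmult[OF G]]
          DERIV_cdivide[OF DERIV_cmult[OF \<Phi>S]]]]) (simp add: field_simps)
  have a_pos: "1/10 \<le> a x" for x
    unfolding a_def using gap gap_le[of x] bump_nonneg[of "?S x"] by (simp add: mult_nonneg_nonneg)
  have g_mono: "g x \<le> g y" if "x \<le> y" for x y
    using that
  proof (rule DERIV_nonneg_imp_nondecreasing)
    fix z show "\<exists>d. (g has_real_derivative d) (at z) \<and> 0 \<le> d"
      using deriv[of z] a_pos[of z] by (intro exI[of _ "a z"]) simp
  qed
  have S_shift: "?S (x + 1) = ?S x" "?C (x + 1) = ?C x" for x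
    by (simp_all add: distrib_left)
  have g_shift: "g (x + 1) = g x + 2" for x
  proof -
    have "\<kappa> * G (x + 1) = \<kappa> * G x + 19/10"
      using \<kappa>w by (simp add: G_shift distrib_left)
    then show ?thesis
      unfolding g_def S_shift by (simp add: add_divide_distrib)
  qed
  have g_odd: "g (- x) = - g x" for x
    by (simp add: g_def G_odd \<Phi>_odd)
  have g_shift_int: "g (x + of_int n) = g x + 2 * of_int n" for x and n :: int
    using shift_of_int[of g 2] g_shift by simp
  have S_shift_int: "?S (x + of_int n) = ?S x" for x and n :: int
    by (simp only: distrib_left sin_add sin_int_2pin cos_int_2pin mult_zero_right mult_1_right add_0_right)

  have quarter: "g (1/4) = 1/4"
    using \<kappa>w \<phi>_ge unfolding g_def \<mu>\<Phi> S_quarter by (simp add: w_def \<phi>_def)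
  \<comment> \<open>The two subtracted terms bound the contributions of \<open>x / 10\<close> and of \<open>\<kappa> G x\<close>; the \<open>\<Phi>\<close> term has the favourable sign.\<close>
  have lower: "1/4 - 1/40 - 95/1800 \<le> g x" if "0 \<le> x" "x \<le> 1/4" "1/10 \<le> ?S x" for x
  proof -
    have "\<kappa> \<le> 19/20 / (\<phi> / pi)"
      unfolding \<kappa>_def using w_ge w_pos \<phi>_ge by (intro divide_left_mono mult_pos_pos) auto
    also have "\<dots> \<le> 19/20 * pi / (1/10)"
      using \<phi>_ge by (simp add: field_simps)
    finally have "\<kappa> \<le> 19/2 * pi"
      by simp
    have "w / 2 - G x \<le> (1/100) / (9/5 * pi)"
      using upper[OF that(1,2)] \<phi>_diff[OF that(3)] by (elim order_trans) (intro divide_right_mono, simp_all)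
    then have "\<kappa> * (w / 2 - G x) \<le> \<kappa> * ((1/100) / (9/5 * pi))"
      using \<kappa>_pos by (intro mult_left_mono) simp_all
    also have "\<dots> \<le> 19/2 * pi * ((1/100) / (9/5 * pi))"
      using \<open>\<kappa> \<le> 19/2 * pi\<close> by (intro mult_right_mono) simp_all
    finally have "\<kappa> * (w / 2 - G x) \<le> 19/2 * pi * ((1/100) / (9/5 * pi))" .
    then have "19/40 - \<kappa> * G x \<le> 95/1800"
      using \<kappa>w by (simp add: right_diff_distrib)
    moreover have "\<Phi> (?S x) / (4 * \<phi>) \<le> 1/4"
      using \<Phi>_mono[of "?S x" 1] \<phi>_ge by (simp add: \<phi>_def field_simps)
    moreover have "0 \<le> x / 10"
      using that by simp
    ultimately show ?thesis
      unfolding g_def \<mu>\<Phi> by linarith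
  qed
  have mid: "1/8 \<le> g x \<and> g x \<le> 3/8" if "0 \<le> x" "x \<le> 1/2" "1/10 \<le> ?S x" for x
  proof (cases "x \<le> 1/4")
    case True
    then show ?thesis
      using lower[of x] g_mono[of x "1/4"] quarter that by simp
  next
    case False
    \<comment> \<open>On the far side the growth is about three times as large; the reflection \<open>x \<mapsto> 1/2 - x\<close> reduces it to the near side.\<close>
    let ?y = "1/2 - x"
    have "1/4 - 1/40 - 95/1800 \<le> g ?y"
      using False that by (intro lower) (simp_all add: sin_2pi_reflect)
    moreover have "g x + g ?y = 1 - \<Phi> (?S x) / (2 * \<phi>)"
    proof -
      have "\<kappa> * G x + \<kappa> * G ?y = 19/20"
        using G_reflect[of x] \<kappa>w by (metis distrib_left)
      then show ?thesis
        unfolding g_def \<mu>\<Phi> sin_2pi_reflect by (simp add: field_simps)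
    qed
    moreover have "5/11 \<le> \<Phi> (?S x) / (2 * \<phi>)"
      using \<Phi>_ge[OF that(3)] \<phi>_ge \<phi>_le by (simp add: field_simps)
    ultimately show ?thesis
      using g_mono[of "1/4" x] quarter False by simp
  qed
  \<comment> \<open>The whole arc lands in \<open>[1/8, 3/8]\<close> modulo one, where the sine exceeds \<open>12/100\<close> by far.\<close>
  have trap: "12/100 \<le> ?S (g x)" if "1/10 \<le> ?S x" for x
  proof -
    define y where "y = frac x"
    have x: "x = y + of_int \<lfloor>x\<rfloor>"
      by (simp add: y_def frac_def)
    have y: "0 \<le> y" "y < 1"
      by (simp_all add: y_def frac_lt_1)
    have Sy: "1/10 \<le> ?S y"
      using that S_shift_int[of y "\<lfloor>x\<rfloor>"] x by simp
    have "y \<le> 1/2"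
    proof (rule ccontr)
      assume "\<not> y \<le> 1/2"
      then have "sin (2 * pi * y) < 0"
        using y by (intro sin_lt_zero) (simp_all add: field_simps)
      with Sy show False
        by simp
    qed
    then have gy: "1/8 \<le> g y" "g y \<le> 3/8"
      using mid[OF y(1) _ Sy] by auto
    have "?S (g x) = ?S (g y)"
      using g_shift_int[of y "\<lfloor>x\<rfloor>"] S_shift_int[of "g y" "2 * \<lfloor>x\<rfloor>"] x by simp
    also have "12/100 \<le> ?S (g y)"
    proof (cases "g y \<le> 1/4")
      case True
      then have "sin (pi / 6) \<le> ?S (g y)"
        using gy pi_gt_zero by (intro sin_monotone_2pi_le) (simp_all add: field_simps)
      then show ?thesis
        by (simp add: sin_30)
    next
      case False
      then have "sin (pi / 6) \<le> ?S (1/2 - g y)"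
        using gy pi_gt_zero by (intro sin_monotone_2pi_le) (simp_all add: field_simps)
      then show ?thesis
        by (simp add: sin_30 sin_2pi_reflect)
    qed
    finally show ?thesis .
  qed
  show thesis
  proof (rule that[of g a])
    show "continuous_on UNIV a"
      unfolding a_def
      by (intro continuous_intros continuous_on_compose2[OF continuous_on_bump[of UNIV]]) auto
    show "6 < a x" if "\<bar>?S x\<bar> \<le> 1/10" for x
      using that gap gap_le[of x] by (simp add: a_def bump_eq_1)
    show "a x = 1/10" if "11/100 \<le> \<bar>?S x\<bar>" for x
      using that by (simp add: a_def bump_eq_0)
    show "?S (g x) \<le> - 12/100" if "?S x \<le> - 1/10" for x
      using trap[of "- x"] that by (simp add: g_odd)
    show "0 < a x" for x
      using a_pos[of x] by simp
    show "a (x + 1) = a x" for x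
      unfolding a_def S_shift ..
  qed (fact deriv g_shift trap)+
qed

section \<open>Lower triangular maps of the plane and skew products\<close>

abbreviation vec2 :: "real \<Rightarrow> real \<Rightarrow> real^2"
  where "vec2 x y \<equiv> x *\<^sub>R axis 1 1 + y *\<^sub>R axis 2 1"

lemma vec2_nth [simp]: "vec2 x y $ 1 = x" "vec2 x y $ 2 = y"
  by (simp_all add: axis_def)

definition lower_triangular :: "real \<Rightarrow> real \<Rightarrow> real \<Rightarrow> (real^2) \<Rightarrow>\<^sub>L (real^2)"
  where "lower_triangular a s d = Blinfun (\<lambda>v. vec2 (a * v $ 1) (s * v $ 1 + d * v $ 2))"

lemma lower_triangular_apply:
  "blinfun_apply (lower_triangular a s d) v = vec2 (a * v $ 1) (s * v $ 1 + d * v $ 2)"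
proof -
  have "linear (\<lambda>v::real^2. vec2 (a * v $ 1) (s * v $ 1 + d * v $ 2))"
    by (rule linearI) (simp_all add: vec_eq_iff forall_2 algebra_simps)
  then show ?thesis
    unfolding lower_triangular_def
    by (subst bounded_linear_Blinfun_apply) (simp_all add: linear_conv_bounded_linear)
qed

lemma continuous_on_lower_triangular:
  fixes a s d :: "'a::t2_space \<Rightarrow> real"
  assumes "continuous_on T a" "continuous_on T s" "continuous_on T d"
  shows "continuous_on T (\<lambda>x. lower_triangular (a x) (s x) (d x))"
  using assms by (intro continuous_on_blinfun_componentwise) (simp add: lower_triangular_apply, intro continuous_intros)

lemma lower_triangular_inverse:
  assumes "a \<noteq> 0" "d \<noteq> 0"
  shows "lower_triangular (1 / a) (- s / (a * d)) (1 / d) o\<^sub>L lower_triangular a s d = id_blinfun"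
  using assms by (intro blinfun_eqI) (simp add: lower_triangular_apply vec_eq_iff forall_2 axis_def field_simps)

definition skew :: "(real \<Rightarrow> real) \<Rightarrow> real^2 \<Rightarrow> real^2"
  where "skew g z = vec2 (g (z $ 1)) (2 * z $ 2 - 20 / pi * cos (2 * pi * z $ 1))"

lemma skew_has_derivative:
  assumes "\<And>x. (g has_real_derivative a x) (at x)"
  shows "(skew g has_derivative blinfun_apply (lower_triangular (a (z $ 1)) (40 * sin (2 * pi * z $ 1)) 2)) (at z)"
proof -
  have nth: "((\<lambda>z. z $ i) has_derivative (\<lambda>v. v $ i)) (at z)" for i and z :: "real^2"
    by (rule bounded_linear_imp_has_derivative) (rule bounded_linear_vec_nth)
  have cos: "((\<lambda>x. 20 / pi * cos (2 * pi * x)) has_real_derivative - 40 * sin (2 * pi * x)) (at x)" for x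
    by (auto intro!: derivative_eq_intros)
  have "(skew g has_derivative (\<lambda>v. vec2 (v $ 1 * a (z $ 1)) (2 * v $ 2 - v $ 1 * (- 40 * sin (2 * pi * z $ 1))))) (at z)"
    unfolding skew_def
    by (intro has_derivative_add has_derivative_scaleR_left has_derivative_diff has_derivative_mult_right
        DERIV_compose_FDERIV[OF assms nth] DERIV_compose_FDERIV[OF cos nth] nth)
  then show ?thesis
    by (rule has_derivative_eq_rhs) (simp add: fun_eq_iff lower_triangular_apply algebra_simps)
qed

section \<open>Cones in the plane and their images under shears\<close>

text \<open>
  The nonnegative set is the double cone around the positive \<open>\<xi>\<close>-axis between the lines \<open>\<xi> = m \<eta>\<close> and
  \<open>\<xi> = - n \<eta>\<close>. Parametrizing the edges by inverse slopes lets an edge cross the vertical axis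
  continuously: it does so when \<open>m\<close> or \<open>n\<close> changes sign.
\<close>

definition cone_form :: "real \<Rightarrow> real \<Rightarrow> real \<Rightarrow> real \<Rightarrow> real"
  where "cone_form m n \<xi> \<eta> = (\<xi> - m * \<eta>) * (\<xi> + n * \<eta>)"

lemma cone_form_uminus: "cone_form m n (- \<xi>) (- \<eta>) = cone_form m n \<xi> \<eta>"
  by (simp add: cone_form_def algebra_simps)

lemma cone_form_swap: "cone_form m n \<xi> (- \<eta>) = cone_form n m \<xi> \<eta>"
  by (simp add: cone_form_def algebra_simps)

text \<open>
  Away from the sinks horizontal stretching by \<open>a > 6\<close> beats vertical stretching and shear, which
  together contribute at most \<open>2 + 4\<close>. The image lies in the open standard cone, which every cone of the
  family contains since its inverse slopes are at most one in absolute value.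
\<close>

lemma standard_cone_step:
  fixes a s \<xi> \<eta> m n :: real
  assumes v: "0 \<le> cone_form 1 1 \<xi> \<eta>" and nz: "\<xi> \<noteq> 0 \<or> \<eta> \<noteq> 0"
    and s: "\<bar>s\<bar> \<le> 4" and a: "6 < a" and m: "\<bar>m\<bar> \<le> 1" and n: "\<bar>n\<bar> \<le> 1"
  shows "0 < cone_form m n (a * \<xi>) (s * \<xi> + 2 * \<eta>)"
    and "\<xi>\<^sup>2 + \<eta>\<^sup>2 < (a * \<xi>)\<^sup>2 + (s * \<xi> + 2 * \<eta>)\<^sup>2"
proof -
  have "\<eta>\<^sup>2 \<le> \<xi>\<^sup>2"
    using v by (simp add: cone_form_def algebra_simps power2_eq_square)
  then have \<eta>: "\<bar>\<eta>\<bar> \<le> \<bar>\<xi>\<bar>"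
    by (simp add: abs_le_square_iff)
  then have \<xi>: "0 < \<bar>\<xi>\<bar>"
    using nz by auto
  have "\<bar>s * \<xi> + 2 * \<eta>\<bar> \<le> \<bar>s\<bar> * \<bar>\<xi>\<bar> + 2 * \<bar>\<eta>\<bar>"
    by (metis abs_mult abs_numeral abs_triangle_ineq)
  also have "\<dots> \<le> 6 * \<bar>\<xi>\<bar>"
    using \<eta> mult_right_mono[OF s, of "\<bar>\<xi>\<bar>"] by simp
  also have "\<dots> < a * \<bar>\<xi>\<bar>"
    using a \<xi> by simp
  finally have less: "\<bar>s * \<xi> + 2 * \<eta>\<bar> < \<bar>a * \<xi>\<bar>"
    using a by (simp add: abs_mult)
  have "\<bar>k * (s * \<xi> + 2 * \<eta>)\<bar> < \<bar>a * \<xi>\<bar>" if "\<bar>k\<bar> \<le> 1" for k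
    using less mult_right_mono[OF that, of "\<bar>s * \<xi> + 2 * \<eta>\<bar>"] by (simp add: abs_mult)
  from this[OF m] this[OF n] show "0 < cone_form m n (a * \<xi>) (s * \<xi> + 2 * \<eta>)"
    unfolding cone_form_def zero_less_mult_iff by arith
  have "\<xi>\<^sup>2 + \<eta>\<^sup>2 \<le> 2 * \<xi>\<^sup>2"
    using \<open>\<eta>\<^sup>2 \<le> \<xi>\<^sup>2\<close> by simp
  also have "\<dots> < (6 * \<xi>)\<^sup>2"
    using \<xi> by (simp add: power_mult_distrib)
  also have "\<dots> \<le> (a * \<xi>)\<^sup>2"
    unfolding power_mult_distrib using a by (intro mult_right_mono power_mono) simp_all
  finally show "\<xi>\<^sup>2 + \<eta>\<^sup>2 < (a * \<xi>)\<^sup>2 + (s * \<xi> + 2 * \<eta>)\<^sup>2"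
    by (smt (verit) zero_le_power2)
qed

lemma tilted_cone_formI:
  assumes "0 < 160 * p + u" and "0 < p + u"
  shows "0 < cone_form (- 1/160) 1 p u"
proof -
  have "0 < p - (- 1/160) * u"
    using assms(1) by simp
  then show ?thesis
    unfolding cone_form_def using assms(2) by simp
qed

text \<open>
  On an arc around the sink with positive shear, the image of the arc is where the upper edge has passed
  the vertical, to inverse slope \<open>- 1/160\<close>. For a vector to the right of the vertical, \<open>\<eta> \<ge> - \<xi>\<close> and
  \<open>s \<ge> 4\<close> make the second coordinate of the image dominate. A vector to the left of the vertical is so
  steep that the shear, at most \<open>40\<close>, costs no more than a quarter of \<open>\<eta>\<close>; there \<open>a = 1/10\<close>, so it
  becomes even steeper. In both cases the vertical stretching by two also gives the expansion.
\<close>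

lemma tilted_cone_step:
  fixes a s \<xi> \<eta> m :: real
  assumes v: "0 \<le> cone_form m 1 \<xi> \<eta>" and nz: "\<xi> \<noteq> 0 \<or> \<eta> \<noteq> 0"
    and a: "0 < a" and s: "4 \<le> s" "s \<le> 40" and m: "- 1/160 \<le> m" "m \<le> 1"
    and thin: "m < 0 \<Longrightarrow> a = 1/10"
  shows "0 < cone_form (- 1/160) 1 (a * \<xi>) (s * \<xi> + 2 * \<eta>)"
    and "\<xi>\<^sup>2 + \<eta>\<^sup>2 < (a * \<xi>)\<^sup>2 + (s * \<xi> + 2 * \<eta>)\<^sup>2"
proof -
  \<comment> \<open>By symmetry it suffices to treat one nappe of the cone.\<close>
  have "0 < cone_form (- 1/160) 1 (a * \<xi>) (s * \<xi> + 2 * \<eta>) \<and> \<xi>\<^sup>2 + \<eta>\<^sup>2 < (s * \<xi> + 2 * \<eta>)\<^sup>2"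
    if v: "0 \<le> \<xi> - m * \<eta>" "0 \<le> \<xi> + \<eta>" and nz: "\<xi> \<noteq> 0 \<or> \<eta> \<noteq> 0" for \<xi> \<eta>
  proof (cases "0 \<le> \<xi>")
    case True
    have "s * \<xi> + 2 * \<eta> \<ge> 4 * \<xi> + 2 * \<eta>"
      using mult_right_mono[OF s(1) True] by simp
    moreover have "0 < 2 * \<xi> + \<bar>\<eta>\<bar>"
      using True nz by auto
    ultimately have *: "2 * \<xi> \<le> s * \<xi> + 2 * \<eta>" "2 * \<eta> \<le> s * \<xi> + 2 * \<eta>" "0 < s * \<xi> + 2 * \<eta>"
      using True v(2) by linarith+
    have "0 \<le> a * \<xi>"
      using True a by simp
    with * have "0 < cone_form (- 1/160) 1 (a * \<xi>) (s * \<xi> + 2 * \<eta>)"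
      by (intro tilted_cone_formI) simp_all
    moreover have "\<xi>\<^sup>2 + \<eta>\<^sup>2 < (s * \<xi> + 2 * \<eta>)\<^sup>2"
    proof -
      have "\<bar>\<eta>\<bar> \<le> \<xi> \<or> \<xi> \<le> \<bar>\<eta>\<bar> \<and> \<eta> = \<bar>\<eta>\<bar>"
        using v(2) True by linarith
      then have "\<xi>\<^sup>2 + \<eta>\<^sup>2 \<le> 2 * (max \<xi> \<bar>\<eta>\<bar>)\<^sup>2" "2 * max \<xi> \<bar>\<eta>\<bar> \<le> s * \<xi> + 2 * \<eta>"
        using * True power_mono[of "\<bar>\<eta>\<bar>" \<xi> 2] power_mono[of \<xi> "\<bar>\<eta>\<bar>" 2] by (auto simp: max_def)
      moreover have "0 < max \<xi> \<bar>\<eta>\<bar>"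
        using nz True by auto
      ultimately obtain M where M: "\<xi>\<^sup>2 + \<eta>\<^sup>2 \<le> 2 * M\<^sup>2" "2 * M \<le> s * \<xi> + 2 * \<eta>" "0 < M"
        by blast
      have "2 * M\<^sup>2 < (2 * M)\<^sup>2"
        using M(3) by (simp add: power2_eq_square)
      also have "\<dots> \<le> (s * \<xi> + 2 * \<eta>)\<^sup>2"
        using M(2,3) by (intro power_mono) simp_all
      finally show ?thesis
        using M(1) by simp
    qed
    ultimately show ?thesis ..
  next
    case False
    then have \<eta>: "0 < \<eta>"
      using v(2) by simp
    have m: "m < 0"
    proof (rule ccontr)
      assume "\<not> m < 0"
      then have "0 \<le> m * \<eta>"
        using \<eta> by simp
      with v(1) False show False
        by simp
    qed
    have \<xi>: "- \<xi> \<le> \<eta> / 160"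
      using v(1) mult_right_mono[OF \<open>- 1/160 \<le> m\<close>, of \<eta>] \<eta> by simp
    have "s * (- \<xi>) \<le> 40 * (- \<xi>)"
      using s False by (intro mult_right_mono) simp_all
    then have *: "7/4 * \<eta> \<le> s * \<xi> + 2 * \<eta>"
      using \<xi> by simp
    have "a * \<xi> = \<xi> / 10"
      using thin[OF m] by simp
    then have "0 < cone_form (- 1/160) 1 (a * \<xi>) (s * \<xi> + 2 * \<eta>)"
      using * \<xi> \<eta> by (intro tilted_cone_formI) linarith+
    moreover have "\<xi>\<^sup>2 + \<eta>\<^sup>2 < (s * \<xi> + 2 * \<eta>)\<^sup>2"
    proof -
      have "\<xi>\<^sup>2 \<le> \<eta>\<^sup>2"
        using \<xi> \<eta> False by (simp add: abs_le_square_iff[symmetric])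
      moreover have "(7/4 * \<eta>)\<^sup>2 \<le> (s * \<xi> + 2 * \<eta>)\<^sup>2"
        using * \<eta> by (intro power_mono) simp_all
      moreover have "2 * \<eta>\<^sup>2 < (7/4 * \<eta>)\<^sup>2"
        using \<eta> by (simp add: power2_eq_square)
      ultimately show ?thesis
        by simp
    qed
    ultimately show ?thesis ..
  qed
  note * = this
  have "0 < cone_form (- 1/160) 1 (a * \<xi>) (s * \<xi> + 2 * \<eta>) \<and> \<xi>\<^sup>2 + \<eta>\<^sup>2 < (s * \<xi> + 2 * \<eta>)\<^sup>2"
  proof (cases "0 \<le> \<xi> - m * \<eta> \<and> 0 \<le> \<xi> + \<eta>")
    case True
    then show ?thesis
      using *[of \<xi> \<eta>] nz by blast
  next
    case False
    then have "\<xi> - m * \<eta> \<le> 0" "\<xi> + \<eta> \<le> 0"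
      using v by (auto simp: cone_form_def zero_le_mult_iff)
    then have "0 < cone_form (- 1/160) 1 (- (a * \<xi>)) (- (s * \<xi> + 2 * \<eta>)) \<and> \<xi>\<^sup>2 + \<eta>\<^sup>2 < (- (s * \<xi> + 2 * \<eta>))\<^sup>2"
      using *[of "- \<xi>" "- \<eta>"] nz by simp
    then show ?thesis
      by (simp only: cone_form_uminus power2_minus)
  qed
  then show "0 < cone_form (- 1/160) 1 (a * \<xi>) (s * \<xi> + 2 * \<eta>)"
    and "\<xi>\<^sup>2 + \<eta>\<^sup>2 < (a * \<xi>)\<^sup>2 + (s * \<xi> + 2 * \<eta>)\<^sup>2"
    using zero_le_power2[of "a * \<xi>"] by linarith+
qed

text \<open>
  Inverse slope of the upper edge over a point with \<open>sin 2\<pi>x = t\<close>; that of the lower edge is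
  \<open>aperture (- t)\<close>. It becomes negative only for \<open>t > 11/100\<close>, where \<open>g\<close> contracts, and has reached its
  minimum at \<open>t = 12/100\<close>, before the image of the arc \<open>t \<ge> 1/10\<close>. The value \<open>- 1/160\<close> is small
  compared with the inverse of the maximal shear.
\<close>

definition aperture :: "real \<Rightarrow> real"
  where "aperture t = max (- 1/160) (min 1 (11 - 100 * t))"

text \<open>
  Here \<open>t\<close> and \<open>t'\<close> are the values of \<open>sin 2\<pi>x\<close> at a point and at its image. The reflection
  \<open>\<eta> \<mapsto> - \<eta>\<close> exchanges the two edges and the sign of the shear, and so the two sinks.
\<close>

lemma skew_cone_step:
  assumes a_pos: "0 < a"
    and strong: "\<bar>t\<bar> \<le> 1/10 \<Longrightarrow> 6 < a"
    and weak: "11/100 \<le> \<bar>t\<bar> \<Longrightarrow> a = 1/10"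
    and right: "1/10 \<le> t \<Longrightarrow> 12/100 \<le> t'"
    and left: "t \<le> - 1/10 \<Longrightarrow> t' \<le> - 12/100"
    and t: "\<bar>t\<bar> \<le> 1"
    and v: "0 \<le> cone_form (aperture t) (aperture (- t)) \<xi> \<eta>" and nz: "\<xi> \<noteq> 0 \<or> \<eta> \<noteq> 0"
  shows "0 < cone_form (aperture t') (aperture (- t')) (a * \<xi>) (40 * t * \<xi> + 2 * \<eta>)
    \<and> \<xi>\<^sup>2 + \<eta>\<^sup>2 < (a * \<xi>)\<^sup>2 + (40 * t * \<xi> + 2 * \<eta>)\<^sup>2"
proof -
  consider "\<bar>t\<bar> \<le> 1/10" | "1/10 < t" | "t < - 1/10"
    by linarith
  then show ?thesis
  proof cases
    case 1
    then have "aperture t = 1" "aperture (- t) = 1"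
      by (auto simp: aperture_def)
    moreover have "\<bar>aperture t'\<bar> \<le> 1" "\<bar>aperture (- t')\<bar> \<le> 1"
      by (auto simp: aperture_def)
    ultimately show ?thesis
      using standard_cone_step[of \<xi> \<eta> "40 * t" a "aperture t'" "aperture (- t')"] v nz strong 1 by simp
  next
    case 2
    then have *: "aperture (- t) = 1" "aperture t' = - 1/160" "aperture (- t') = 1"
      using right by (auto simp: aperture_def)
    moreover have "- 1/160 \<le> aperture t" "aperture t \<le> 1" "aperture t < 0 \<Longrightarrow> a = 1/10"
      using weak 2 by (auto simp: aperture_def)
    ultimately show ?thesis
      using tilted_cone_step[of "aperture t" \<xi> \<eta> a "40 * t"] v nz 2 t a_pos by simp
  next
    case 3
    then have *: "aperture t = 1" "aperture (- t') = - 1/160" "aperture t' = 1"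
      using left by (auto simp: aperture_def)
    moreover have "- 1/160 \<le> aperture (- t)" "aperture (- t) \<le> 1" "aperture (- t) < 0 \<Longrightarrow> a = 1/10"
      using weak 3 by (auto simp: aperture_def)
    moreover have "0 \<le> cone_form (aperture (- t)) 1 \<xi> (- \<eta>)"
      using v * by (simp add: cone_form_swap)
    ultimately have "0 < cone_form (- 1/160) 1 (a * \<xi>) (- (40 * t * \<xi> + 2 * \<eta>)) 
       \<and> \<xi>\<^sup>2 + (- \<eta>)\<^sup>2 < (a * \<xi>)\<^sup>2 + (- (40 * t * \<xi> + 2 * \<eta>))\<^sup>2"
      using tilted_cone_step[of "aperture (- t)" \<xi> "- \<eta>" a "- 40 * t"] nz 3 t a_pos by (simp add: algebra_simps)
    then show ?thesis
      using * by (simp only: cone_form_swap power2_minus)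
  qed
qed

definition cone_matrix :: "real \<Rightarrow> real \<Rightarrow> real^2^2"
  where "cone_matrix m n = (\<chi> i j. if i = j then if i = 1 then 1 else - m * n else (n - m) / 2)"

lemma quad_form_cone_matrix: "quad_form (cone_matrix m n) v = cone_form m n (v $ 1) (v $ 2)"
  by (simp add: quad_form_def cone_matrix_def cone_form_def inner_vec_def matrix_vector_mult_def sum_2 field_simps)

lemma transpose_cone_matrix: "transpose (cone_matrix m n) = cone_matrix m n"
  by (simp add: cone_matrix_def transpose_def vec_eq_iff)

lemma det_cone_matrix: "det (cone_matrix m n) = - ((m + n) / 2)\<^sup>2"
  by (simp add: det_2 cone_matrix_def power2_eq_square field_simps)

lemma continuous_on_cone_matrix:
  assumes "continuous_on T m" "continuous_on T n"
  shows "continuous_on T (\<lambda>x. cone_matrix (m x) (n x))"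
  unfolding cone_matrix_def
proof (intro continuous_on_vec_lambda)
  fix i j :: 2
  show "continuous_on T (\<lambda>x. if i = j then if i = 1 then 1 else - m x * n x else (n x - m x) / 2)"
    by (cases "i = j"; cases "i = 1") (simp_all add: continuous_intros assms)
qed

lemma aperture_sum_pos: "0 < aperture t + aperture (- t)"
  by (auto simp: aperture_def max_def min_def)

lemma continuous_on_aperture: "continuous_on T aperture"
  unfolding aperture_def by (intro continuous_intros)

lemma cone_matrix_indefinite:
  assumes "0 < m + n"
  shows "\<exists>v. 0 < quad_form (cone_matrix m n) v" and "\<exists>v. quad_form (cone_matrix m n) v < 0"
proof -
  have "0 < quad_form (cone_matrix m n) (vec2 1 0)"
    unfolding quad_form_cone_matrix vec2_nth by (simp add: cone_form_def)
  then show "\<exists>v. 0 < quad_form (cone_matrix m n) v"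
    by blast
  have "quad_form (cone_matrix m n) (vec2 ((m - n) / 2) 1) = - ((m + n) / 2)\<^sup>2"
    unfolding quad_form_cone_matrix vec2_nth by (simp add: cone_form_def power2_eq_square field_simps)
  moreover have "0 < ((m + n) / 2)\<^sup>2"
    using assms by simp
  ultimately have "quad_form (cone_matrix m n) (vec2 ((m - n) / 2) 1) < 0"
    by simp
  then show "\<exists>v. quad_form (cone_matrix m n) v < 0"
    by blast
qed

lemma interior_quad_cone:
  assumes "0 < quad_form A v"
  shows "v \<in> interior {v. 0 \<le> quad_form A v}"
proof (rule interiorI)
  have "continuous_on UNIV (quad_form A)"
    unfolding quad_form_def[abs_def]
    by (intro continuous_on_inner continuous_on_id linear_continuous_on matrix_vector_mul_bounded_linear)
  then show "open {v. 0 < quad_form A v}"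
    by (intro open_Collect_less) auto
qed (use assms in auto)

lemma norm_vec2_squared: "(norm v)\<^sup>2 = (v $ 1)\<^sup>2 + (v $ 2)\<^sup>2" for v :: "real^2"
  unfolding power2_norm_eq_inner inner_vec_def sum_2 by (simp add: power2_eq_square)

section \<open>The partially hyperbolic endomorphism\<close>

theorem corollary3:
  shows "\<exists>f :: torus \<Rightarrow> torus.
    partially_hyperbolic_endo f \<and>
    homotopic_with_canon (\<lambda>_. True) UNIV UNIV f
      (torus_linear (vector [vector [2, 0], vector [0, 2]]))"
proof -
  let ?S = "\<lambda>x. sin (2 * pi * x)"
  obtain g a :: "real \<Rightarrow> real" where
    g: "\<And>x. (g has_real_derivative a x) (at x)" and cont_a: "continuous_on UNIV a"
    and g_shift: "\<And>x. g (x + 1) = g x + 2" and a_shift: "\<And>x. a (x + 1) = a x"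
    and a_pos: "\<And>x. 0 < a x"
    and strong: "\<And>x. \<bar>?S x\<bar> \<le> 1/10 \<Longrightarrow> 6 < a x"
    and weak: "\<And>x. 11/100 \<le> \<bar>?S x\<bar> \<Longrightarrow> a x = 1/10"
    and right: "\<And>x. 1/10 \<le> ?S x \<Longrightarrow> 12/100 \<le> ?S (g x)"
    and left: "\<And>x. ?S x \<le> - 1/10 \<Longrightarrow> ?S (g x) \<le> - 12/100"
    by (rule exists_circle_map_two_sinks) blast
  define F' where "F' z = lower_triangular (a (z $ 1)) (40 * ?S (z $ 1)) 2" for z :: "real^2"
  define A where "A z = cone_matrix (aperture (?S (z $ 1))) (aperture (- ?S (z $ 1)))" for z :: "real^2"
  define f where "f = torus_map (skew g)"
  define C where "C p = {v. 0 \<le> quad_form (A (torus_rep p)) v}" for p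

  have periodic: "?S (z $ 1) = ?S (w $ 1)" "cos (2 * pi * z $ 1) = cos (2 * pi * w $ 1)"
    "a (z $ 1) = a (w $ 1)" "g (z $ 1) - g (w $ 1) = 2 * (z $ 1 - w $ 1)"
    if rel: "torus_rel z w" for z w
  proof -
    from rel obtain n where n: "z $ 1 - w $ 1 = of_int n"
      unfolding torus_rel_def by (blast elim: Ints_cases)
    then have z: "z $ 1 = w $ 1 + of_int n"
      by simp
    show "?S (z $ 1) = ?S (w $ 1)" "cos (2 * pi * z $ 1) = cos (2 * pi * w $ 1)"
      unfolding z distrib_left sin_add cos_add sin_int_2pin cos_int_2pin by simp_all
    show "a (z $ 1) = a (w $ 1)"
      unfolding z using shift_of_int[of a 0] a_shift by simp
    show "g (z $ 1) - g (w $ 1) = 2 * (z $ 1 - w $ 1)"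
      unfolding n unfolding z using shift_of_int[of g 2] g_shift by simp
  qed
  have diff: "skew g z - skew g w = 2 *\<^sub>R z - 2 *\<^sub>R w" if "torus_rel z w" for z w
    using periodic[OF that] by (simp add: skew_def vec_eq_iff forall_2 axis_def)
  have rel: "torus_rel (skew g z) (skew g w)" if "torus_rel z w" for z w
  proof -
    have "skew g z $ i - skew g w $ i = 2 * (z $ i - w $ i)" for i
      using diff[OF that] by (simp add: vec_eq_iff right_diff_distrib)
    then show ?thesis
      using that by (simp only: torus_rel_def) (blast intro: Ints_mult Ints_numeral)
  qed
  have F'_rel: "F' z = F' w" and A_rel: "A z = A w" if "torus_rel z w" for z w
    using periodic[OF that] by (simp_all add: F'_def A_def)
  have der: "(skew g has_derivative blinfun_apply (F' z)) (at z)" for z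
    unfolding F'_def by (rule skew_has_derivative[OF g])
  have cont_S: "continuous_on UNIV (\<lambda>z::real^2. ?S (z $ 1))"
    by (intro continuous_intros)
  have cont_a1: "continuous_on UNIV (\<lambda>z::real^2. a (z $ 1))"
    by (rule continuous_on_compose2[OF cont_a]) (auto intro: continuous_intros)
  have cont_F': "continuous_on UNIV F'"
    unfolding F'_def by (intro continuous_on_lower_triangular continuous_intros cont_S cont_a1)
  have cont_A: "continuous_on UNIV A"
    unfolding A_def
    by (intro continuous_on_cone_matrix continuous_on_compose2[OF continuous_on_aperture[of UNIV]] continuous_intros cont_S) auto
  have f_proj: "f (torus_proj z) = torus_proj (skew g z)" for z
    unfolding f_def by (rule torus_map_proj[OF rel])
  have deriv_f: "torus_deriv f (torus_proj z) = blinfun_apply (F' z)" for z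
    unfolding f_def by (intro torus_deriv_eqI torus_has_derivative_torus_map rel der)
  have C_proj: "C (torus_proj z) = {v. 0 \<le> quad_form (A z) v}" for z
    using A_rel[OF torus_rel_rep_proj[of z]] by (simp add: C_def)
  have step: "0 < quad_form (A (skew g z)) (blinfun_apply (F' z) v) \<and> norm v < norm (blinfun_apply (F' z) v)"
    if "0 \<le> quad_form (A z) v" "v \<noteq> 0" for z v
  proof -
    have "v $ 1 \<noteq> 0 \<or> v $ 2 \<noteq> 0"
      using \<open>v \<noteq> 0\<close> by (simp add: vec_eq_iff forall_2)
    moreover have "0 \<le> cone_form (aperture (?S (z $ 1))) (aperture (- ?S (z $ 1))) (v $ 1) (v $ 2)"
      using that(1) by (simp add: A_def quad_form_cone_matrix)
    ultimately have *: "0 < cone_form (aperture (?S (g (z $ 1)))) (aperture (- ?S (g (z $ 1)))) (a (z $ 1) * v $ 1) (40 * ?S (z $ 1) * v $ 1 + 2 * v $ 2)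
      \<and> (v $ 1)\<^sup>2 + (v $ 2)\<^sup>2 < (a (z $ 1) * v $ 1)\<^sup>2 + (40 * ?S (z $ 1) * v $ 1 + 2 * v $ 2)\<^sup>2"
      by (intro skew_cone_step) (assumption | rule a_pos strong weak right left abs_sin_le_one)+
    have "skew g z $ 1 = g (z $ 1)"
      unfolding skew_def by (rule vec2_nth)
    moreover have "(norm v)\<^sup>2 < (norm (blinfun_apply (F' z) v))\<^sup>2"
      using * unfolding norm_vec2_squared F'_def lower_triangular_apply vec2_nth by blast
    ultimately show ?thesis
      using * unfolding A_def F'_def quad_form_cone_matrix lower_triangular_apply vec2_nth
      by (auto intro: power2_less_imp_less)
  qed

  have "torus_C1_local_diffeo f"
    unfolding f_def
  proof (rule torus_C1_local_diffeo_torus_map[OF rel F'_rel der cont_F'])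
    let ?E = "\<lambda>z::real^2. lower_triangular (1 / a (z $ 1)) (- (40 * ?S (z $ 1)) / (a (z $ 1) * 2)) (1 / 2)"
    show "?E z o\<^sub>L F' z = id_blinfun" for z
      unfolding F'_def using a_pos[of "z $ 1"] by (intro lower_triangular_inverse) simp_all
    show "continuous_on UNIV ?E"
      using a_pos by (intro continuous_on_lower_triangular continuous_intros cont_S cont_a1) (simp_all add: less_imp_neq[symmetric])
  qed
  moreover have "cone_family C"
    unfolding cone_family_def
  proof (intro exI[of _ "\<lambda>p. A (torus_rep p)"] conjI allI)
    show "continuous_on UNIV (\<lambda>p. A (torus_rep p))"
      by (rule continuous_on_descend[OF cont_A A_rel])
    fix p
    note pos = aperture_sum_pos[of "?S (torus_rep p $ 1)"]
    show "transpose (A (torus_rep p)) = A (torus_rep p)"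
      by (simp add: A_def transpose_cone_matrix)
    show "det (A (torus_rep p)) \<noteq> 0"
      using pos by (simp add: A_def det_cone_matrix)
    show "\<exists>v. 0 < quad_form (A (torus_rep p)) v" "\<exists>v. quad_form (A (torus_rep p)) v < 0"
      unfolding A_def by (rule cone_matrix_indefinite[OF pos])+
    show "C p = {v. 0 \<le> quad_form (A (torus_rep p)) v}"
      by (rule C_def)
  qed
  moreover have "cone_family_invariant f C"
    unfolding cone_family_invariant_def
  proof (intro allI subsetI)
    fix p u assume u: "u \<in> torus_deriv f p ` C p - {0}"
    obtain z where p: "p = torus_proj z"
      using torus_proj_surj by blast
    from u obtain v where v: "0 \<le> quad_form (A z) v" "u = blinfun_apply (F' z) v" "u \<noteq> 0"
      unfolding p deriv_f C_proj by blast
    then have "v \<noteq> 0"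
      by auto
    with v have "0 < quad_form (A (skew g z)) u"
      using step by blast
    then show "u \<in> interior (C (f p))"
      unfolding p f_proj C_proj by (rule interior_quad_cone)
  qed
  moreover have "\<forall>p. \<forall>v\<in>C p. norm v = 1 \<longrightarrow> norm (torus_deriv (f ^^ 1) p v) > 1"
  proof (intro allI ballI impI)
    fix p v assume v: "v \<in> C p" "norm v = 1"
    obtain z where p: "p = torus_proj z"
      using torus_proj_surj by blast
    have "v \<noteq> 0" "0 \<le> quad_form (A z) v"
      using v by (auto simp: p C_proj)
    then show "norm (torus_deriv (f ^^ 1) p v) > 1"
      using step[of z v] v(2) by (simp add: p deriv_f)
  qed
  ultimately have "partially_hyperbolic_endo f"
    unfolding partially_hyperbolic_endo_def using zero_less_one by blast
  moreover have "torus_linear (vector [vector [2, 0], vector [0, 2]]) = torus_map (\<lambda>z. 2 *\<^sub>R z)"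
  proof
    fix p
    have "(\<chi> i j. real_of_int ((vector [vector [2, 0], vector [0, 2]] :: int^2^2) $ i $ j)) *v z = 2 *\<^sub>R z" for z
      by (simp add: vec_eq_iff forall_2 matrix_vector_mult_def sum_2)
    then have "torus_linear (vector [vector [2, 0], vector [0, 2]]) (torus_proj z) = torus_proj (2 *\<^sub>R z)" for z
      by (simp add: torus_linear.abs_eq)
    from this[of "torus_rep p"] show "torus_linear (vector [vector [2, 0], vector [0, 2]]) p = torus_map (\<lambda>z. 2 *\<^sub>R z) p"
      by (simp add: torus_map_def)
  qed
  moreover have "homotopic_with_canon (\<lambda>_. True) UNIV UNIV f (torus_map (\<lambda>z. 2 *\<^sub>R z))"
    unfolding f_def
  proof (rule homotopic_torus_map[OF _ _ rel diff])
    show "continuous_on UNIV (skew g)"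
      by (intro continuous_at_imp_continuous_on ballI has_derivative_continuous[OF der])
  qed (intro continuous_intros)
  ultimately show ?thesis
    by (intro exI[of _ f]) simp
qed

end
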